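(* Let $P=\{x\in\mathbb{R}^n : Ax\le b\}$ be a bounded polyhedron (polytope), let $S\subset\mathbb{R}^n$ be a nonempty closed set, and let $\lambda\ge 0$. Define $P_0(\lambda):=P$ and, recursively for $k\ge 0$, $$P_{k+1}(\lambda) := \bigcap_{x\in\mathrm{ext}(P_{k}(\lambda))} \mathrm{conv}\bigl(P_{k}(\lambda) \setminus \mathrm{int}(\mathcal{B}(x,\max\{d(x,S)-\lambda,0\}))\bigr),$$ and let $P_\infty(\lambda):=\bigcap_{k=0}^\infty P_k(\lambda)$. Then $$P_{\infty}(\lambda) \subseteq \mathrm{conv}(P\cap S_\lambda),$$ where $S_\lambda$ is the $\lambda$-fattening of $S$.
   Context: Notation: $\mathrm{ext}(\cdot)$ is the set of extreme points of a convex set, $\mathrm{int}(\cdot)$ the interior, $\mathrm{conv}(\cdot)$ the convex hull. $\mathcal{B}(x,r)$ is the closed Euclidean ball with center $x$ and radius $r$ (with empty interior if $r=0$). $d(x,S):=\inf_{s\in S}\|x-s\|_2$. The $\epsilon$-fattening of a set $X\subseteq\mathbb{R}^n$ is $X_\epsilon:=\bigcup_{x\in X}\mathcal{B}(x,\epsilon)$. *)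

theory Defs
  imports "HOL-Analysis.Analysis"
begin

definition fattening :: "real \<Rightarrow> 'a::metric_space set \<Rightarrow> 'a set" where
  "fattening \<epsilon> X = (\<Union>x\<in>X. cball x \<epsilon>)"

text \<open>
  If \<open>P\<^sub>k\<close> is empty, the intersection below ranges over no extreme points and is \<open>UNIV\<close>.
  This does not affect the intersection over all \<open>k\<close>, which is then empty because of \<open>P\<^sub>k\<close>
  itself.  For nonempty \<open>S\<close>, \<open>infdist x S\<close> is the infimum of the distances from \<open>x\<close> to
  points of \<open>S\<close>.
\<close>

primrec ball_cut_iterate ::
  "'a::euclidean_space set \<Rightarrow> 'a set \<Rightarrow> real \<Rightarrow> nat \<Rightarrow> 'a set" where
  "ball_cut_iterate P S lam 0 = P"
| "ball_cut_iterate P S lam (Suc k) =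
     (\<Inter>x\<in>{x. x extreme_point_of ball_cut_iterate P S lam k}.
        convex hull (ball_cut_iterate P S lam k - interior (cball x (max (infdist x S - lam) 0))))"

definition ball_cut_limit ::
  "'a::euclidean_space set \<Rightarrow> 'a set \<Rightarrow> real \<Rightarrow> 'a set" where
  "ball_cut_limit P S lam = (\<Inter>k. ball_cut_iterate P S lam k)"

end

theory Submission
  imports Defs
begin

text \<open>
  If some iterate is empty, so is the limit.  Otherwise the iterates \<open>P\<^sub>k\<close> form a decreasing sequence of compact
  convex sets, so by Minkowski's theorem the limit \<open>P\<^sub>\<infinity>\<close> is the convex hull of its extreme
  points, and it suffices that every extreme point \<open>x\<close> of \<open>P\<^sub>\<infinity>\<close> has distance at most \<open>\<lambda>\<close>
  from \<open>S\<close>: since \<open>S\<close> is closed, such a point lies in the fattening.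

  Suppose instead that \<open>d(x,S) = \<lambda> + r\<close> with \<open>r > 0\<close>.  The extreme points of the iterates need
  not include \<open>x\<close>, but some of them come close to it.  A closed half-space with \<open>x\<close> in its
  interior cuts an arbitrarily small cap off \<open>P\<^sub>\<infinity>\<close> around its extreme point \<open>x\<close>, and by
  compactness the same half-space cuts a small cap off \<open>P\<^sub>k\<close> for some \<open>k\<close>
  (\<open>extreme_point_of_Inter_small_cap\<close>).  The cap of \<open>P\<^sub>k\<close> contains the point \<open>x\<close> of \<open>P\<^sub>k\<close>,
  hence also an extreme point \<open>e\<close> of \<open>P\<^sub>k\<close> (\<open>exists_extreme_point_in_halfspace\<close>).  The distance
  to \<open>S\<close> is 1-Lipschitz, so the radius \<open>d(e,S) - \<lambda>\<close> of the ball around \<open>e\<close> is nearly \<open>r\<close>, and the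
  ball swallows the whole cap.  Cutting it out therefore leaves nothing of \<open>P\<^sub>k\<close> in the
  half-space, so \<open>x\<close> is not in \<open>P\<^sub>k\<^sub>+\<^sub>1\<close> (\<open>extreme_point_of_ball_cut_limit_infdist_le\<close>), which
  contradicts \<open>x \<in> P\<^sub>\<infinity>\<close>.
\<close>

text \<open>
  If no extreme point of \<open>K\<close> lay in the open half-space, all of them would lie in the closed
  complementary one, and with them \<open>x\<close>, since \<open>K\<close> is the convex hull of its extreme points.
\<close>

lemma exists_extreme_point_in_halfspace:
  fixes K :: "'a::euclidean_space set"
  assumes "compact K" "convex K" "x \<in> K" "a \<bullet> x < b"
  obtains e where "e extreme_point_of K" "a \<bullet> e < b"
proof (rule ccontr)
  assume "\<not> thesis"
  then have "{e. e extreme_point_of K} \<subseteq> {y. a \<bullet> y \<ge> b}"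
    using that by fastforce
  then have "convex hull {e. e extreme_point_of K} \<subseteq> {y. a \<bullet> y \<ge> b}"
    by (rule hull_minimal) (rule convex_halfspace_ge)
  with assms show False
    using Krein_Milman_Minkowski[of K] by auto
qed

text \<open>
  An extreme point \<open>x\<close> of the intersection \<open>L\<close> is not in the convex hull of the points of \<open>L\<close>
  at distance at least \<open>\<epsilon>\<close> from \<open>x\<close>.  This hull is compact, so a hyperplane separates it
  strictly from \<open>x\<close>.  The points of \<open>K n\<close> on the side of \<open>x\<close> that are \<open>\<epsilon>\<close>-far from \<open>x\<close> thus
  form decreasing compact sets with empty intersection, and one of them must be empty.
\<close>

lemma extreme_point_of_Inter_small_cap:
  fixes K :: "nat \<Rightarrow> 'a::euclidean_space set"
  assumes comp: "\<And>n. compact (K n)" and dec: "decseq K"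
    and ext: "x extreme_point_of (\<Inter>n. K n)" and cvx: "convex (\<Inter>n. K n)" and "\<epsilon> > 0"
  obtains a b n where "a \<bullet> x < b" "\<And>y. y \<in> K n \<Longrightarrow> a \<bullet> y \<le> b \<Longrightarrow> dist x y < \<epsilon>"
proof -
  let ?L = "\<Inter>n. K n"
  let ?far = "convex hull (?L - ball x \<epsilon>)"
  have "compact ?L"
    using comp by (intro compact_Inter) auto
  then have "compact ?far"
    by (intro compact_convex_hull compact_diff) auto
  have "x \<notin> ?far"
  proof
    assume "x \<in> ?far"
    moreover have "?far \<subseteq> ?L"
      using cvx by (intro hull_minimal) auto
    ultimately have "x extreme_point_of ?far"
      using ext unfolding extreme_point_of_def by blast
    then have "x \<in> ?L - ball x \<epsilon>"
      by (rule extreme_point_of_convex_hull)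
    with \<open>\<epsilon> > 0\<close> show False by simp
  qed
  then obtain a b where ab: "a \<bullet> x < b" "\<And>y. y \<in> ?far \<Longrightarrow> a \<bullet> y > b"
    using separating_hyperplane_closed_point[of ?far x] compact_imp_closed[OF \<open>compact ?far\<close>]
    by auto
  define F where "F n = K n \<inter> {y. a \<bullet> y \<le> b} - ball x \<epsilon>" for n
  have "\<Inter>(range F) = {}"
  proof (rule equals0I)
    fix y assume "y \<in> \<Inter>(range F)"
    then have "y \<in> ?L - ball x \<epsilon>" "a \<bullet> y \<le> b"
      by (auto simp: F_def)
    then show False
      using ab(2)[of y] hull_inc[of y] by fastforce
  qed
  moreover have "compact (F n)" for n
    unfolding F_def
    by (intro compact_diff compact_Int_closed comp closed_halfspace_le open_ball)
  moreover have "F n \<subseteq> F m" if "m \<le> n" for m n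
    using decseqD[OF dec that] by (auto simp: F_def)
  ultimately obtain n where "F n = {}"
    using compact_nest[of F] by blast
  with ab(1) show thesis
    by (intro that[of a b n]) (auto simp: F_def)
qed

lemma ball_cut_iterate_Suc_subset:
  assumes "compact (ball_cut_iterate P S lam k)" "convex (ball_cut_iterate P S lam k)"
    and "ball_cut_iterate P S lam k \<noteq> {}"
  shows "ball_cut_iterate P S lam (Suc k) \<subseteq> ball_cut_iterate P S lam k"
proof -
  let ?K = "ball_cut_iterate P S lam k"
  obtain e where e: "e extreme_point_of ?K"
    using extreme_point_exists_convex[OF assms] .
  have "convex hull (?K - T) \<subseteq> ?K" for T
    using assms(2) by (intro hull_minimal) auto
  with e show ?thesis by fastforce
qed

text \<open>
  A nonempty compact convex iterate has an extreme point, so the intersection defining the next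
  iterate is not over the empty family; otherwise it would be all of space and hence unbounded.
\<close>

lemma compact_convex_ball_cut_iterate:
  assumes "compact P" "convex P" and nonempty: "\<And>k. ball_cut_iterate P S lam k \<noteq> {}"
  shows "compact (ball_cut_iterate P S lam k) \<and> convex (ball_cut_iterate P S lam k)"
proof (induction k)
  case 0
  with assms show ?case by simp
next
  case (Suc k)
  let ?K = "ball_cut_iterate P S lam k"
  let ?cut = "\<lambda>x. convex hull (?K - interior (cball x (max (infdist x S - lam) 0)))"
  have "compact (?cut x)" for x
    using Suc by (intro compact_convex_hull compact_diff) auto
  moreover have "{x. x extreme_point_of ?K} \<noteq> {}"
    using extreme_point_exists_convex[of ?K] Suc nonempty[of k] by blast
  ultimately have "compact (\<Inter>x\<in>{x. x extreme_point_of ?K}. ?cut x)"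
    by (intro compact_Inter) auto
  moreover have "convex (\<Inter>x\<in>{x. x extreme_point_of ?K}. ?cut x)"
    by (intro convex_INT convex_convex_hull)
  ultimately show ?case by simp
qed

text \<open>
  With \<open>r\<close> the excess of the distance over \<open>\<lambda>\<close>, a cap within \<open>r / 3\<close> of \<open>x\<close> is small enough: an
  extreme point \<open>e\<close> of the iterate in the cap is less than \<open>2 * r / 3\<close> away from every point of
  the cap, while the ball removed around \<open>e\<close> has radius greater than \<open>r - r / 3\<close>.
\<close>

lemma extreme_point_of_ball_cut_limit_infdist_le:
  assumes comp: "\<And>k. compact (ball_cut_iterate P S lam k)"
    and cvx: "\<And>k. convex (ball_cut_iterate P S lam k)"
    and ext: "x extreme_point_of ball_cut_limit P S lam"
  shows "infdist x S \<le> lam"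
proof (rule ccontr)
  let ?K = "ball_cut_iterate P S lam"
  assume "\<not> infdist x S \<le> lam"
  define r where "r = infdist x S - lam"
  have "r > 0"
    using \<open>\<not> infdist x S \<le> lam\<close> by (simp add: r_def)
  have x: "x \<in> ?K k" for k
    using ext by (auto simp: extreme_point_of_def ball_cut_limit_def)
  have "decseq ?K"
    using x ball_cut_iterate_Suc_subset[OF comp cvx] by (intro decseq_SucI) blast
  then obtain a b k where "a \<bullet> x < b"
    and cap: "\<And>y. y \<in> ?K k \<Longrightarrow> a \<bullet> y \<le> b \<Longrightarrow> dist x y < r / 3"
    using extreme_point_of_Inter_small_cap[of ?K x "r / 3"] comp cvx ext \<open>r > 0\<close>
    by (metis ball_cut_limit_def convex_INT divide_pos_pos zero_less_numeral)
  obtain e where e: "e extreme_point_of ?K k" "a \<bullet> e < b"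
    using exists_extreme_point_in_halfspace[OF comp cvx x \<open>a \<bullet> x < b\<close>] .
  let ?\<rho> = "max (infdist e S - lam) 0"
  have "dist x e < r / 3"
    using cap e by (simp add: extreme_point_of_def)
  then have "infdist e S - lam > 2 * r / 3"
    using infdist_triangle[of x S e] r_def by linarith
  then have "?\<rho> > 2 * r / 3"
    by (rule less_le_trans) simp
  have "?K k - interior (cball e ?\<rho>) \<subseteq> {y. a \<bullet> y \<ge> b}"
  proof
    fix y assume y: "y \<in> ?K k - interior (cball e ?\<rho>)"
    have "\<not> a \<bullet> y \<le> b"
    proof
      assume "a \<bullet> y \<le> b"
      with cap y have "dist x y < r / 3" by simp
      with \<open>dist x e < r / 3\<close> \<open>?\<rho> > 2 * r / 3\<close> have "dist e y < ?\<rho>"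
        using dist_triangle3[of e y x] by linarith
      with y show False by simp
    qed
    then show "y \<in> {y. a \<bullet> y \<ge> b}" by simp
  qed
  then have "convex hull (?K k - interior (cball e ?\<rho>)) \<subseteq> {y. a \<bullet> y \<ge> b}"
    by (rule hull_minimal) (rule convex_halfspace_ge)
  moreover have "x \<in> convex hull (?K k - interior (cball e ?\<rho>))"
    using x[of "Suc k"] e(1) by simp
  ultimately show False
    using \<open>a \<bullet> x < b\<close> by auto
qed

lemma ball_cut_limit_subset_convex_hull_fattening:
  assumes "compact P" "convex P" "closed S" "S \<noteq> {}"
  shows "ball_cut_limit P S lam \<subseteq> convex hull (P \<inter> fattening lam S)"
proof (cases "\<exists>k. ball_cut_iterate P S lam k = {}")
  case True
  then show ?thesis by (auto simp: ball_cut_limit_def)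
next
  case False
  let ?L = "ball_cut_limit P S lam"
  have comp: "compact (ball_cut_iterate P S lam k)"
    and cvx: "convex (ball_cut_iterate P S lam k)" for k
    using compact_convex_ball_cut_iterate[OF assms(1,2)] False by blast+
  have "e \<in> P \<inter> fattening lam S" if "e extreme_point_of ?L" for e
  proof
    have "e \<in> ball_cut_iterate P S lam 0"
      using that unfolding extreme_point_of_def ball_cut_limit_def by blast
    then show "e \<in> P" by simp
    obtain s where "s \<in> S" "infdist e S = dist e s"
      using infdist_attains_inf[OF assms(3,4)] by blast
    moreover have "infdist e S \<le> lam"
      using extreme_point_of_ball_cut_limit_infdist_le[OF comp cvx that] .
    ultimately show "e \<in> fattening lam S"
      by (auto simp: fattening_def dist_commute)
  qed
  then have "convex hull {e. e extreme_point_of ?L} \<subseteq> convex hull (P \<inter> fattening lam S)"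
    by (intro hull_mono) blast
  moreover have "compact ?L" "convex ?L"
    using comp cvx by (auto simp: ball_cut_limit_def intro!: compact_Inter convex_INT)
  ultimately show ?thesis
    using Krein_Milman_Minkowski[of ?L] by simp
qed

theorem theorem6:
  fixes A :: "real ^ 'n ^ 'm" and b :: "real ^ 'm"
    and P S :: "(real ^ 'n) set" and lam :: real
  assumes "P = {x. A *v x \<le> b}"
    and "bounded P"
    and "closed S"
    and "S \<noteq> {}"
    and "lam \<ge> 0"
  shows "ball_cut_limit P S lam \<subseteq> convex hull (P \<inter> fattening lam S)"
proof -
  have P: "P = (\<Inter>i. {x. row i A \<bullet> x \<le> b $ i})"
    unfolding assms(1) by (auto simp: less_eq_vec_def matrix_vector_mul_component row_def)
  have "closed P"
    unfolding P by (intro closed_INT ballI closed_halfspace_le)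
  with assms(2) have "compact P"
    by (simp add: compact_eq_bounded_closed)
  moreover have "convex P"
    unfolding P by (intro convex_INT convex_halfspace_le)
  ultimately show ?thesis
    using assms(3,4) by (rule ball_cut_limit_subset_convex_hull_fattening)
qed

end
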